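(* Let $f : \mathcal{A}^{\mathbb{Z}} \to \mathcal{A}^{\mathbb{Z}}$ be a one-dimensional cellular automaton over a finite alphabet $\mathcal{A}$. If its generic limit set $\widetilde\omega(f)$ is inclusion-minimal, then its language $\mathcal{L}(\widetilde\omega(f)) \subset \mathcal{A}^*$ is a $\Pi^0_2$ set.
   Context: $\mathcal{A}^{\mathbb{Z}}$ carries the product of the discrete topologies. A (one-dimensional) cellular automaton (CA) is a map $f : \mathcal{A}^{\mathbb{Z}} \to \mathcal{A}^{\mathbb{Z}}$ of the form $f(x)_i = F(x_{i-r},\dots,x_{i+r})$ for some $r \in \mathbb{N}$ and $F : \mathcal{A}^{2r+1} \to \mathcal{A}$. A set is meager if it is a countable union of sets whose closures have empty interior, and comeager if its complement is meager. For $x \in \mathcal{A}^{\mathbb{Z}}$ let $\omega(x) = \bigcap_{N \in \mathbb{N}} \overline{\{f^n(x) \mid n \ge N\}}$, and for a closed set $K \subset \mathcal{A}^{\mathbb{Z}}$ let $\mathcal{D}(K) = \{x \mid \omega(x) \subset K\}$ be its basin (realm) of attraction. $K$ is an attractor if $\mathcal{D}(K)$ is nonmeager and a generic attractor if $\mathcal{D}(K)$ is comeager. The generic limit set $\widetilde\omega(f)$ is the intersection of all generic attractors; it is the smallest generic attractor, and it is a nonempty closed shift-invariant set. An attractor $K$ is inclusion-minimal if $\mathcal{D}(B)$ is meager for every closed set $B \subsetneq K$. The language $\mathcal{L}(X)$ of $X \subset \mathcal{A}^{\mathbb{Z}}$ is the set of all finite words over $\mathcal{A}$ occurring as (contiguous)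 subwords of configurations in $X$. $\Pi^0_2$ refers to the arithmetical hierarchy for subsets of the countable set $\mathcal{A}^*$ (under a standard computable coding). *)

theory Defs
  imports "HOL-Analysis.Analysis" "HOL-Library.Nat_Bijection"
begin

section \<open>Cellular automata and their generic limit sets\<close>

text \<open>Configurations are functions \<^typ>\<open>int \<Rightarrow> 'a\<close>; the finiteness of the alphabet
  \<^typ>\<open>'a\<close> is only imposed in the theorem. Since all index sets and factors are full types,
  every function is a point of the product space.\<close>

definition config_topology :: "(int \<Rightarrow> 'a) topology" where
  "config_topology = product_topology (\<lambda>_. discrete_topology UNIV) UNIV"

text \<open>The local rule is applied only to lists of length $2r+1$; its values elsewhere are
  irrelevant.\<close>

definition cellular_automaton :: "((int \<Rightarrow> 'a) \<Rightarrow> (int \<Rightarrow> 'a)) \<Rightarrow> bool" where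
  "cellular_automaton f \<longleftrightarrow>
     (\<exists>(r::nat) (F :: 'a list \<Rightarrow> 'a). \<forall>x i. f x i = F (map x [i - int r..i + int r]))"

definition meager :: "(int \<Rightarrow> 'a) set \<Rightarrow> bool" where
  "meager S \<longleftrightarrow> (\<exists>\<N>. countable \<N> \<and> S = \<Union>\<N> \<and>
     (\<forall>N\<in>\<N>. config_topology interior_of (config_topology closure_of N) = {}))"

definition comeager :: "(int \<Rightarrow> 'a) set \<Rightarrow> bool" where
  "comeager S \<longleftrightarrow> meager (- S)"

definition omega_limit :: "((int \<Rightarrow> 'a) \<Rightarrow> (int \<Rightarrow> 'a)) \<Rightarrow> (int \<Rightarrow> 'a) \<Rightarrow> (int \<Rightarrow> 'a) set" where
  "omega_limit f x = (\<Inter>N. config_topology closure_of {(f ^^ n) x |n. n \<ge> N})"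

definition basin :: "((int \<Rightarrow> 'a) \<Rightarrow> (int \<Rightarrow> 'a)) \<Rightarrow> (int \<Rightarrow> 'a) set \<Rightarrow> (int \<Rightarrow> 'a) set" where
  "basin f K = {x. omega_limit f x \<subseteq> K}"

definition attractor :: "((int \<Rightarrow> 'a) \<Rightarrow> (int \<Rightarrow> 'a)) \<Rightarrow> (int \<Rightarrow> 'a) set \<Rightarrow> bool" where
  "attractor f K \<longleftrightarrow> closedin config_topology K \<and> \<not> meager (basin f K)"

definition generic_attractor :: "((int \<Rightarrow> 'a) \<Rightarrow> (int \<Rightarrow> 'a)) \<Rightarrow> (int \<Rightarrow> 'a) set \<Rightarrow> bool" where
  "generic_attractor f K \<longleftrightarrow> closedin config_topology K \<and> comeager (basin f K)"

definition generic_limit_set :: "((int \<Rightarrow> 'a) \<Rightarrow> (int \<Rightarrow> 'a)) \<Rightarrow> (int \<Rightarrow> 'a) set" where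
  "generic_limit_set f = \<Inter>{K. generic_attractor f K}"

definition inclusion_minimal :: "((int \<Rightarrow> 'a) \<Rightarrow> (int \<Rightarrow> 'a)) \<Rightarrow> (int \<Rightarrow> 'a) set \<Rightarrow> bool" where
  "inclusion_minimal f K \<longleftrightarrow> attractor f K \<and>
     (\<forall>B. closedin config_topology B \<and> B \<subset> K \<longrightarrow> meager (basin f B))"

definition language :: "(int \<Rightarrow> 'a) set \<Rightarrow> 'a list set" where
  "language X = {w. \<exists>x\<in>X. \<exists>i. w = map (\<lambda>k. x (i + int k)) [0..<length w]}"


section \<open>Recursive relations and $\Pi^0_2$ sets\<close>

text \<open>Programs for the partial $\mu$-recursive functions, with their evaluation relation.
  Primitive recursion runs on the first argument, and its step function receives the
  recursion index, the previous value and the parameters, in this order. Minimization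
  searches for the first argument and requires all earlier values to be defined.\<close>

datatype recf = Zero | Succ | Proj nat | Comp recf "recf list" | PrimRec recf recf | Mu recf

inductive evaluates :: "recf \<Rightarrow> nat list \<Rightarrow> nat \<Rightarrow> bool" where
  zero: "evaluates Zero xs 0"
| succ: "evaluates Succ [x] (Suc x)"
| proj: "i < length xs \<Longrightarrow> evaluates (Proj i) xs (xs ! i)"
| comp: "length ys = length gs \<Longrightarrow> (\<forall>i<length gs. evaluates (gs ! i) xs (ys ! i)) \<Longrightarrow>
    evaluates h ys z \<Longrightarrow> evaluates (Comp h gs) xs z"
| prim_0: "evaluates g xs z \<Longrightarrow> evaluates (PrimRec g h) (0 # xs) z"
| prim_Suc: "evaluates (PrimRec g h) (n # xs) y \<Longrightarrow> evaluates h (n # y # xs) z \<Longrightarrow>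
    evaluates (PrimRec g h) (Suc n # xs) z"
| mu: "evaluates g (n # xs) 0 \<Longrightarrow> (\<forall>m<n. \<exists>y. evaluates g (m # xs) (Suc y)) \<Longrightarrow>
    evaluates (Mu g) xs n"

definition decidable3 :: "(nat \<Rightarrow> nat \<Rightarrow> nat \<Rightarrow> bool) \<Rightarrow> bool" where
  "decidable3 R \<longleftrightarrow> (\<exists>p. \<forall>x y z. evaluates p [x, y, z] (if R x y z then 1 else 0))"

definition Pi02 :: "nat set \<Rightarrow> bool" where
  "Pi02 S \<longleftrightarrow> (\<exists>R. decidable3 R \<and> S = {x. \<forall>y. \<exists>z. R x y z})"

text \<open>Words are coded by numbering the letters and applying the recursive bijection
  \<^const>\<open>list_encode\<close> between lists of naturals and naturals. For a finite alphabet any two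
  injective numberings yield computably equivalent codings, so the quantification over all of
  them is harmless.\<close>

definition Pi02_words :: "'a list set \<Rightarrow> bool" where
  "Pi02_words L \<longleftrightarrow>
     (\<forall>num :: 'a \<Rightarrow> nat. inj num \<longrightarrow> Pi02 ((\<lambda>w. list_encode (map num w)) ` L))"

end

theory Submission
  imports Defs
begin

text \<open>Write $\omega$ for the generic limit set. Inclusion-minimality removes one quantifier
  alternation from the description of its language, through Baire category. The basin of $\omega$
  is comeager (\<open>comeager_basin_generic_limit_set\<close>). If a word $s$ occurs in $\omega$ at
  position $i$, then removing the cylinder of these occurrences leaves a proper closed subset,
  whose basin is meager by minimality; hence generic points have an orbit that stays near $\omega$
  but visits this cylinder infinitely often, and in particular every nonempty open set contains,
  for every $N$, a point that visits the cylinder after time $N$. Conversely, if this happens in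
  every open set, then the points visiting after time $N$ form a dense open set for each $N$, so a
  generic point visits infinitely often; by compactness its limit set contains an occurrence of
  $s$, and generically that limit set lies in $\omega$. So $s$ is in the language if and only if
  every pattern and every $N$ admit a later visit from a point extending the pattern
  (\<open>densely_recurrent_if_in_language\<close>, \<open>generic_limit_set_meets_word\<close>). This condition commutes with
  the shift, so the position $i$ need not be quantified.

  For a cellular automaton a visit is witnessed by a finite space-time diagram, which can be
  checked mechanically. After a shift of coordinates all its cells have natural coordinates
  and the rule reads only cells to the right
  (\<open>in_language_generic_limit_set_iff\<close>). The pattern and the time bound become one universally
  quantified number, the diagram one existentially quantified number.

  It remains to see that checking a coded diagram is recursive
  (\<open>recursive_code_diagram\<close>). Closure properties of the recursive functions give
  arithmetic, bounded quantification, and access to the entries of coded lists; the local rule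
  is a finite table because the alphabet is finite.\<close>


section \<open>Closure properties of recursive functions\<close>

definition recursive_fun :: "nat \<Rightarrow> (nat list \<Rightarrow> nat) \<Rightarrow> bool" where
  "recursive_fun k G \<longleftrightarrow> (\<exists>p. \<forall>xs. length xs = k \<longrightarrow> evaluates p xs (G xs))"

definition recursive_pred :: "nat \<Rightarrow> (nat list \<Rightarrow> bool) \<Rightarrow> bool" where
  "recursive_pred k P \<longleftrightarrow> recursive_fun k (\<lambda>xs. of_bool (P xs))"

lemma recursive_fun_cong:
  assumes "recursive_fun k G" and "\<And>xs. length xs = k \<Longrightarrow> G xs = H xs"
  shows "recursive_fun k H"
  using assms unfolding recursive_fun_def by metis

lemma recursive_proj: "i < k \<Longrightarrow> recursive_fun k (\<lambda>xs. xs ! i)"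
  unfolding recursive_fun_def by (metis evaluates.proj)

text \<open>Under a quantifier or a recursion the bound variables are put in front of the list of arguments,
  so that the outer arguments are reached by dropping them.\<close>

lemma recursive_proj_drop: "m + i < k \<Longrightarrow> recursive_fun k (\<lambda>xs. drop m xs ! i)"
  by (rule recursive_fun_cong[OF recursive_proj[of "m + i"]]) auto

lemma recursive_proj_drop_drop:
  "m + m' + i < k \<Longrightarrow> recursive_fun k (\<lambda>xs. drop m (drop m' xs) ! i)"
  by (simp add: recursive_proj_drop)

lemma recursive_comp:
  assumes H: "recursive_fun (length gs) H" and gs: "\<And>g. g \<in> set gs \<Longrightarrow> recursive_fun k g"
  shows "recursive_fun k (\<lambda>xs. H (map (\<lambda>g. g xs) gs))"
proof -
  obtain p where p: "\<And>ys. length ys = length gs \<Longrightarrow> evaluates p ys (H ys)"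
    using H unfolding recursive_fun_def by auto
  obtain q where q: "\<And>g xs. g \<in> set gs \<Longrightarrow> length xs = k \<Longrightarrow> evaluates (q g) xs (g xs)"
    using gs unfolding recursive_fun_def by metis
  have "evaluates (Comp p (map q gs)) xs (H (map (\<lambda>g. g xs) gs))" if "length xs = k" for xs
    by (rule evaluates.comp[where ys = "map (\<lambda>g. g xs) gs"]) (auto intro: p q that)
  then show ?thesis
    unfolding recursive_fun_def by blast
qed

lemma recursive_comp1:
  assumes "recursive_fun 1 (\<lambda>ys. h (ys ! 0))" and "recursive_fun k a"
  shows "recursive_fun k (\<lambda>xs. h (a xs))"
  using recursive_comp[of "[a]" "\<lambda>ys. h (ys ! 0)" k] assms by simp

lemma recursive_comp2:
  assumes "recursive_fun 2 (\<lambda>ys. h (ys ! 0) (ys ! 1))"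
    and "recursive_fun k a" and "recursive_fun k b"
  shows "recursive_fun k (\<lambda>xs. h (a xs) (b xs))"
  using recursive_comp[of "[a, b]" "\<lambda>ys. h (ys ! 0) (ys ! 1)" k] assms
  by (auto simp: numeral_2_eq_2)

lemma recursive_Suc:
  assumes "recursive_fun k a"
  shows "recursive_fun k (\<lambda>xs. Suc (a xs))"
proof (rule recursive_comp1[OF _ assms])
  have "evaluates Succ ys (Suc (ys ! 0))" if "length ys = 1" for ys
    using that evaluates.succ[of "ys ! 0"] by (cases ys) auto
  then show "recursive_fun 1 (\<lambda>ys. Suc (ys ! 0))"
    unfolding recursive_fun_def by blast
qed

lemma recursive_const: "recursive_fun k (\<lambda>_. c)"
proof (induction c)
  case 0
  then show ?case
    unfolding recursive_fun_def by (metis evaluates.zero)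
qed (rule recursive_Suc)

text \<open>The recursion index is the value of a further function rather than an argument, which is what
  makes the rule applicable to terms. It is reduced to the program for primitive recursion by
  substituting this value for the first argument.\<close>

lemma recursive_rec_nat:
  assumes G: "recursive_fun k G" and H: "recursive_fun (Suc (Suc k)) (\<lambda>ys. h (ys ! 0) (ys ! 1) (drop 2 ys))"
    and a: "recursive_fun k a"
  shows "recursive_fun k (\<lambda>xs. rec_nat (G xs) (\<lambda>n y. h n y xs) (a xs))"
proof -
  obtain p q where p: "\<And>xs. length xs = k \<Longrightarrow> evaluates p xs (G xs)"
    and q: "\<And>ys. length ys = Suc (Suc k) \<Longrightarrow> evaluates q ys (h (ys ! 0) (ys ! 1) (drop 2 ys))"
    using G H unfolding recursive_fun_def by auto
  have eval: "evaluates (PrimRec p q) (n # xs) (rec_nat (G xs) (\<lambda>n y. h n y xs) n)"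
    if "length xs = k" for n xs
  proof (induction n)
    case 0
    then show ?case using p that by (auto intro: evaluates.prim_0)
  next
    case (Suc n)
    then show ?case
      using q[of "n # rec_nat (G xs) (\<lambda>n y. h n y xs) n # xs"] that
      by (auto intro: evaluates.prim_Suc)
  qed
  have "evaluates (PrimRec p q) ys (rec_nat (G (tl ys)) (\<lambda>n y. h n y (tl ys)) (hd ys))"
    if "length ys = Suc k" for ys
    using eval[of "tl ys" "hd ys"] that by (cases ys) auto
  then have "recursive_fun (Suc k) (\<lambda>ys. rec_nat (G (tl ys)) (\<lambda>n y. h n y (tl ys)) (hd ys))"
    unfolding recursive_fun_def by blast
  then have "recursive_fun (length (a # map (\<lambda>i xs. xs ! i) [0..<k]))
      (\<lambda>ys. rec_nat (G (tl ys)) (\<lambda>n y. h n y (tl ys)) (hd ys))"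
    by simp
  then have "recursive_fun k (\<lambda>xs. (\<lambda>ys. rec_nat (G (tl ys)) (\<lambda>n y. h n y (tl ys)) (hd ys))
      (map (\<lambda>g. g xs) (a # map (\<lambda>i xs. xs ! i) [0..<k])))"
    by (rule recursive_comp) (auto simp: a intro: recursive_proj)
  then show ?thesis
    by (rule recursive_fun_cong) (auto simp: comp_def map_nth)
qed

text \<open>Minimization stops at the value 0, hence the negation: the search continues as long as the
  characteristic function of \<^term>\<open>P\<close> is 1.\<close>

lemma recursive_Least:
  assumes G: "recursive_pred (Suc k) (\<lambda>ys. P (ys ! 0) (drop 1 ys))"
    and ex: "\<And>xs. length xs = k \<Longrightarrow> \<exists>n. \<not> P n xs"
  shows "recursive_fun k (\<lambda>xs. LEAST n. \<not> P n xs)"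
proof -
  obtain p where p: "\<And>ys. length ys = Suc k \<Longrightarrow> evaluates p ys (of_bool (P (ys ! 0) (drop 1 ys)))"
    using G unfolding recursive_fun_def recursive_pred_def by auto
  have "evaluates (Mu p) xs (LEAST n. \<not> P n xs)" if l: "length xs = k" for xs
  proof (rule evaluates.mu)
    have pn: "evaluates p (n # xs) (of_bool (P n xs))" for n
      using p[of "n # xs"] l by simp
    show "evaluates p ((LEAST n. \<not> P n xs) # xs) 0"
      using pn[of "LEAST n. \<not> P n xs"] LeastI_ex[OF ex[OF l]] by simp
    show "\<forall>m<LEAST n. \<not> P n xs. \<exists>y. evaluates p (m # xs) (Suc y)"
    proof (intro allI impI)
      fix m assume "m < (LEAST n. \<not> P n xs)"
      then show "\<exists>y. evaluates p (m # xs) (Suc y)"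
        using pn[of m] not_less_Least[of m "\<lambda>n. \<not> P n xs"] by auto
    qed
  qed
  then show ?thesis
    unfolding recursive_fun_def by blast
qed

lemma recursive_add:
  assumes "recursive_fun k a" and "recursive_fun k b"
  shows "recursive_fun k (\<lambda>xs. a xs + b xs)"
proof -
  have "rec_nat c (\<lambda>n y. Suc y) d = d + c" for c d :: nat
    by (induction d) auto
  moreover have "recursive_fun k (\<lambda>xs. rec_nat (b xs) (\<lambda>n y. Suc y) (a xs))"
    by (intro recursive_rec_nat assms recursive_Suc recursive_proj) auto
  ultimately show ?thesis by simp
qed

lemma recursive_mult:
  assumes "recursive_fun k a" and "recursive_fun k b"
  shows "recursive_fun k (\<lambda>xs. a xs * b xs)"
proof (rule recursive_comp2[OF _ assms])
  have "rec_nat 0 (\<lambda>n y. y + c) d = d * c" for c d :: nat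
    by (induction d) auto
  moreover have "recursive_fun 2 (\<lambda>xs. rec_nat 0 (\<lambda>n y. y + xs ! 1) (xs ! 0))"
    by (intro recursive_rec_nat recursive_const recursive_add recursive_proj recursive_proj_drop) auto
  ultimately show "recursive_fun 2 (\<lambda>xs. xs ! 0 * xs ! 1)" by simp
qed

lemma recursive_diff:
  assumes "recursive_fun k a" and "recursive_fun k b"
  shows "recursive_fun k (\<lambda>xs. a xs - b xs)"
proof (rule recursive_comp2[OF _ assms])
  have "rec_nat 0 (\<lambda>n y. n) d = d - 1" for d :: nat
    by (cases d) auto
  moreover have "recursive_fun 1 (\<lambda>xs. rec_nat 0 (\<lambda>n y. n) (xs ! 0))"
    by (intro recursive_rec_nat recursive_const recursive_proj) auto
  ultimately have pred: "recursive_fun 1 (\<lambda>xs. xs ! 0 - 1)" by simp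
  have "rec_nat c (\<lambda>n y. y - 1) d = c - d" for c d :: nat
    by (induction d) auto
  moreover have "recursive_fun 2 (\<lambda>xs. rec_nat (xs ! 0) (\<lambda>n y. y - 1) (xs ! 1))"
    by (intro recursive_rec_nat recursive_comp1[OF pred] recursive_proj) auto
  ultimately show "recursive_fun 2 (\<lambda>xs. xs ! 0 - xs ! 1)" by simp
qed

lemma recursive_of_bool: "recursive_pred k P \<Longrightarrow> recursive_fun k (\<lambda>xs. of_bool (P xs))"
  unfolding recursive_pred_def .

lemma recursive_not:
  assumes "recursive_pred k P"
  shows "recursive_pred k (\<lambda>xs. \<not> P xs)"
proof -
  have "recursive_fun k (\<lambda>xs. 1 - of_bool (P xs))"
    using assms by (intro recursive_diff recursive_const recursive_of_bool)
  then show ?thesis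
    unfolding recursive_pred_def by (rule recursive_fun_cong) auto
qed

lemma recursive_conj:
  assumes "recursive_pred k P" and "recursive_pred k Q"
  shows "recursive_pred k (\<lambda>xs. P xs \<and> Q xs)"
proof -
  have "recursive_fun k (\<lambda>xs. of_bool (P xs) * of_bool (Q xs))"
    using assms by (intro recursive_mult recursive_of_bool)
  then show ?thesis
    unfolding recursive_pred_def by (rule recursive_fun_cong) auto
qed

lemma recursive_disj:
  assumes "recursive_pred k P" and "recursive_pred k Q"
  shows "recursive_pred k (\<lambda>xs. P xs \<or> Q xs)"
  using recursive_not[OF recursive_conj[OF assms[THEN recursive_not]]] by simp

lemma recursive_const_pred: "recursive_pred k (\<lambda>_. b)"
  unfolding recursive_pred_def by (rule recursive_const)

lemma recursive_le:
  assumes "recursive_fun k a" and "recursive_fun k b"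
  shows "recursive_pred k (\<lambda>xs. a xs \<le> b xs)"
proof -
  have "recursive_fun k (\<lambda>xs. 1 - (a xs - b xs))"
    using assms by (intro recursive_diff recursive_const)
  then show ?thesis
    unfolding recursive_pred_def by (rule recursive_fun_cong) auto
qed

lemma recursive_eq:
  assumes "recursive_fun k a" and "recursive_fun k b"
  shows "recursive_pred k (\<lambda>xs. a xs = b xs)"
  using recursive_conj[OF recursive_le recursive_le, OF assms assms(2,1)]
  by (simp add: eq_iff)

text \<open>A bounded quantifier is a product of characteristic functions, computed by primitive recursion.
  The step function also receives the previous value as its second argument, so the matrix must be
  composed with the projections that skip this argument.\<close>

lemma recursive_bounded_all:
  assumes "recursive_pred (Suc k) (\<lambda>ys. P (ys ! 0) (drop 1 ys))" and "recursive_fun k b"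
  shows "recursive_pred k (\<lambda>xs. \<forall>i<b xs. P i xs)"
proof -
  have rec: "rec_nat 1 (\<lambda>i y. y * of_bool (P i xs)) n = (of_bool (\<forall>i<n. P i xs) :: nat)" for n xs
    by (induction n) (auto simp: less_Suc_eq)
  have "recursive_fun (length ((\<lambda>ys. ys ! 0) # map (\<lambda>i ys. ys ! (i + 2)) [0..<k]))
      (\<lambda>ys. of_bool (P (ys ! 0) (drop 1 ys)))"
    using assms(1) by (simp add: recursive_pred_def)
  then have "recursive_fun (Suc (Suc k)) (\<lambda>zs. (\<lambda>ys. of_bool (P (ys ! 0) (drop 1 ys)))
      (map (\<lambda>g. g zs) ((\<lambda>ys. ys ! 0) # map (\<lambda>i ys. ys ! (i + 2)) [0..<k])))"
    by (rule recursive_comp) (auto intro: recursive_proj)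
  then have "recursive_fun (Suc (Suc k)) (\<lambda>ys. of_bool (P (ys ! 0) (drop 2 ys)))"
  proof (rule recursive_fun_cong)
    fix ys :: "nat list"
    assume "length ys = Suc (Suc k)"
    then have "map (\<lambda>i. ys ! (i + 2)) [0..<k] = drop 2 ys"
      by (intro nth_equalityI) (auto simp: add.commute)
    then show "of_bool (P ((map (\<lambda>g. g ys) ((\<lambda>ys. ys ! 0) # map (\<lambda>i ys. ys ! (i + 2)) [0..<k])) ! 0)
        (drop 1 (map (\<lambda>g. g ys) ((\<lambda>ys. ys ! 0) # map (\<lambda>i ys. ys ! (i + 2)) [0..<k])))) =
        (of_bool (P (ys ! 0) (drop 2 ys)) :: nat)"
      by (simp add: comp_def)
  qed
  then have "recursive_fun k (\<lambda>xs. rec_nat 1 (\<lambda>i y. y * of_bool (P i xs)) (b xs))"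
    using assms(2) by (intro recursive_rec_nat recursive_mult recursive_const recursive_proj) auto
  then show ?thesis
    unfolding rec recursive_pred_def .
qed

lemma recursive_all_in_finite:
  assumes "finite A" and "\<And>a. a \<in> A \<Longrightarrow> recursive_pred k (P a)"
  shows "recursive_pred k (\<lambda>xs. \<forall>a\<in>A. P a xs)"
  using assms by (induction A) (auto intro: recursive_const_pred recursive_conj)

lemma recursive_sum:
  assumes "finite A" and "\<And>a. a \<in> A \<Longrightarrow> recursive_fun k (g a)"
  shows "recursive_fun k (\<lambda>xs. \<Sum>a\<in>A. g a xs)"
  using assms by (induction A) (auto intro: recursive_const recursive_add)

section \<open>Coded pairs, lists and letters\<close>

lemma recursive_triangle:
  assumes "recursive_fun k a"
  shows "recursive_fun k (\<lambda>xs. triangle (a xs))"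
proof -
  have "rec_nat 0 (\<lambda>n y. y + Suc n) m = triangle m" for m
    by (induction m) auto
  moreover have "recursive_fun k (\<lambda>xs. rec_nat 0 (\<lambda>n y. y + Suc n) (a xs))"
    by (intro recursive_rec_nat assms recursive_const recursive_add recursive_Suc recursive_proj) auto
  ultimately show ?thesis by simp
qed

text \<open>The pair $(a, b)$ is coded on the diagonal $s = a + b$, whose codes run from
  \<^term>\<open>triangle s\<close> to \<^term>\<open>triangle s + s\<close>. So the diagonal is found by minimization and both
  components are then arithmetical.\<close>

lemma prod_decode_conv:
  fixes n :: nat
  defines "s \<equiv> LEAST s. \<not> triangle (Suc s) \<le> n"
  shows "prod_decode n = (n - triangle s, s - (n - triangle s))"
proof -
  obtain a b where n: "n = prod_encode (a, b)"
    by (metis prod_decode_inverse surj_pair)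
  have mono: "triangle i \<le> triangle j" if "i \<le> j" for i j
    using that by (induction rule: dec_induct) auto
  have "s = a + b"
    unfolding s_def
  proof (rule Least_equality)
    show "\<not> triangle (Suc (a + b)) \<le> n"
      by (simp add: n prod_encode_def)
    fix t assume "\<not> triangle (Suc t) \<le> n"
    then show "a + b \<le> t"
      using mono[of "Suc t" "a + b"] by (fastforce simp: n prod_encode_def not_less_eq_eq)
  qed
  then show ?thesis
    by (simp add: n) (simp add: prod_encode_def)
qed

lemma recursive_prod_decode:
  assumes "recursive_fun k a"
  shows "recursive_fun k (\<lambda>xs. fst (prod_decode (a xs)))"
    and "recursive_fun k (\<lambda>xs. snd (prod_decode (a xs)))"
proof -
  have "recursive_fun 1 (\<lambda>xs. LEAST s. \<not> triangle (Suc s) \<le> xs ! 0)"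
  proof (rule recursive_Least)
    show "recursive_pred (Suc 1) (\<lambda>ys. triangle (Suc (ys ! 0)) \<le> drop 1 ys ! 0)"
      by (intro recursive_le recursive_triangle recursive_Suc recursive_proj recursive_proj_drop) auto
    show "\<exists>s. \<not> triangle (Suc s) \<le> xs ! 0" for xs :: "nat list"
      by (rule exI[of _ "xs ! 0"]) (simp del: triangle_Suc add: triangle_Suc[of "xs ! 0"])
  qed
  then have L: "recursive_fun k (\<lambda>xs. LEAST s. \<not> triangle (Suc s) \<le> a xs)"
    using recursive_comp1[of "\<lambda>m. LEAST s. \<not> triangle (Suc s) \<le> m"] assms by blast
  show "recursive_fun k (\<lambda>xs. fst (prod_decode (a xs)))"
    "recursive_fun k (\<lambda>xs. snd (prod_decode (a xs)))"
    unfolding prod_decode_conv fst_conv snd_conv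
    by (intro recursive_diff recursive_triangle L assms)+
qed

text \<open>A nonempty list is coded by the successor of the pair of its head and the code of its tail.
  With truncated subtraction the tail of the code 0 of the empty list is again 0, so that the
  length is the number of tails that can be taken before 0 appears. Entries beyond the
  length are 0.\<close>

definition code_tail :: "nat \<Rightarrow> nat" where
  "code_tail c = snd (prod_decode (c - 1))"

definition code_nth :: "nat \<Rightarrow> nat \<Rightarrow> nat" where
  "code_nth c i = fst (prod_decode ((code_tail ^^ i) c - 1))"

definition code_length :: "nat \<Rightarrow> nat" where
  "code_length c = length (list_decode c)"

lemma code_tail_funpow: "(code_tail ^^ i) (list_encode xs) = list_encode (drop i xs)"
proof (induction i)
  case (Suc i)
  have "prod_decode 0 = (0, 0)"
    using prod_encode_inverse[of "(0, 0)"] by (simp add: prod_encode_def)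
  then have "code_tail (list_encode zs) = list_encode (tl zs)" for zs
    by (cases zs) (auto simp: code_tail_def)
  then show ?case
    using Suc by (simp add: drop_Suc tl_drop)
qed simp

lemma code_nth_list_encode: "i < length xs \<Longrightarrow> code_nth (list_encode xs) i = xs ! i"
  by (simp add: code_nth_def code_tail_funpow flip: Cons_nth_drop_Suc)

lemma code_nth_conv: "i < code_length c \<Longrightarrow> code_nth c i = list_decode c ! i"
  using code_nth_list_encode[of i "list_decode c"] by (simp add: code_length_def)

lemma code_length_conv: "code_length c = (LEAST l. \<not> (code_tail ^^ l) c \<noteq> 0)"
proof -
  have "(code_tail ^^ l) c = 0 \<longleftrightarrow> code_length c \<le> l" for l
  proof -
    have "(code_tail ^^ l) c = list_encode (drop l (list_decode c))"
      using code_tail_funpow[of l "list_decode c"] by simp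
    moreover have "list_encode zs = 0 \<longleftrightarrow> zs = []" for zs
      by (cases zs) auto
    ultimately show ?thesis by (simp add: code_length_def)
  qed
  then show ?thesis
    by (auto intro!: Least_equality[symmetric])
qed

lemma recursive_code_tail_funpow:
  assumes "recursive_fun k a" and "recursive_fun k b"
  shows "recursive_fun k (\<lambda>xs. (code_tail ^^ b xs) (a xs))"
proof -
  have "rec_nat c (\<lambda>n y. code_tail y) i = (code_tail ^^ i) c" for c i
    by (induction i) auto
  moreover have "recursive_fun k (\<lambda>xs. rec_nat (a xs) (\<lambda>n y. code_tail y) (b xs))"
    unfolding code_tail_def
    by (intro recursive_rec_nat assms recursive_prod_decode recursive_diff recursive_proj recursive_const) auto
  ultimately show ?thesis by simp
qed

lemma recursive_code_nth:
  assumes "recursive_fun k a" and "recursive_fun k b"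
  shows "recursive_fun k (\<lambda>xs. code_nth (a xs) (b xs))"
  unfolding code_nth_def
  by (intro recursive_prod_decode recursive_diff recursive_code_tail_funpow assms recursive_const)

lemma recursive_code_length:
  assumes "recursive_fun k a"
  shows "recursive_fun k (\<lambda>xs. code_length (a xs))"
proof (rule recursive_comp1[OF _ assms])
  show "recursive_fun 1 (\<lambda>xs. code_length (xs ! 0))"
    unfolding code_length_conv
  proof (rule recursive_Least)
    show "recursive_pred (Suc 1) (\<lambda>ys. (code_tail ^^ (ys ! 0)) (drop 1 ys ! 0) \<noteq> 0)"
      by (intro recursive_not recursive_eq recursive_code_tail_funpow recursive_proj recursive_proj_drop
          recursive_const) auto
    show "\<exists>l. \<not> (code_tail ^^ l) (xs ! 0) \<noteq> 0" for xs :: "nat list"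
      using code_tail_funpow[of "length (list_decode (xs ! 0))" "list_decode (xs ! 0)"] by auto
  qed
qed

text \<open>Numbers outside the range of \<^term>\<open>num\<close> all decode to the same unspecified letter, since the
  choice in the inverse is then made from the empty set. So the numbers that decode to a given
  letter form a finite or a cofinite set.\<close>

lemma recursive_letter:
  fixes num :: "'a::finite \<Rightarrow> nat"
  assumes "inj num" and "recursive_fun k c"
  shows "recursive_pred k (\<lambda>xs. inv num (c xs) = a)"
proof -
  have num: "inv num m = a \<longleftrightarrow>
     m = num a \<or> (a = (SOME b. False) \<and> (\<forall>n\<in>range num. \<not> m = n))" for m
  proof (cases "m \<in> range num")
    case True
    then show ?thesis using assms(1) by auto
  next
    case False
    then have "(\<lambda>b. num b = m) = (\<lambda>b. False)" by auto
    then have "inv num m = (SOME b. False)" 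
      by (simp add: inv_into_def)
    then show ?thesis using False by auto
  qed
  show ?thesis
    unfolding num
    by (intro recursive_disj recursive_conj recursive_all_in_finite recursive_not recursive_eq
        assms recursive_const recursive_const_pred) auto
qed

text \<open>There are only finitely many words of length \<^term>\<open>m\<close>, so any function of such a word is
  a finite table, whether or not it is given by an algorithm. This is how the local rule of the
  automaton becomes recursive.\<close>

lemma recursive_on_letters:
  fixes num :: "'a::finite \<Rightarrow> nat" and \<Phi> :: "'a list \<Rightarrow> nat"
  assumes "inj num"
  shows "recursive_fun m (\<lambda>xs. \<Phi> (map (inv num) xs))"
proof -
  let ?W = "{w :: 'a list. length w = m}"
  have fin: "finite ?W"
    using finite_lists_length_eq[of "UNIV :: 'a set" m] by simp
  have "recursive_fun m (\<lambda>xs. \<Sum>w\<in>?W. \<Phi> w * of_bool (\<forall>i\<in>{..<m}. inv num (xs ! i) = w ! i))"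
    using fin assms by (intro recursive_sum recursive_mult recursive_const recursive_of_bool 
       recursive_all_in_finite recursive_letter recursive_proj) auto
  then show ?thesis
  proof (rule recursive_fun_cong)
    fix xs :: "nat list" assume l: "length xs = m"
    have "(\<forall>i\<in>{..<m}. inv num (xs ! i) = w ! i) \<longleftrightarrow> w = map (inv num) xs" if "w \<in> ?W" for w
      using that l by (auto simp: list_eq_iff_nth_eq)
    then have "(\<Sum>w\<in>?W. \<Phi> w * of_bool (\<forall>i\<in>{..<m}. inv num (xs ! i) = w ! i)) =
      (\<Sum>w\<in>?W. if w = map (inv num) xs then \<Phi> w else 0)"
      by (intro sum.cong) auto
    also have "\<dots> = \<Phi> (map (inv num) xs)"
      using fin l by (simp add: sum.delta)
    finally show "(\<Sum>w\<in>?W. \<Phi> w * of_bool (\<forall>i\<in>{..<m}. inv num (xs ! i) = w ! i)) = \<Phi> (map (inv num) xs)" .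
  qed
qed

lemma recursive_letters:
  fixes num :: "'a::finite \<Rightarrow> nat" and \<Phi> :: "'a list \<Rightarrow> nat"
  assumes "inj num" and "\<And>j. j < m \<Longrightarrow> recursive_fun k (e j)"
  shows "recursive_fun k (\<lambda>xs. \<Phi> (map (\<lambda>j. inv num (e j xs)) [0..<m]))"
proof -
  have "recursive_fun (length (map e [0..<m])) (\<lambda>xs. \<Phi> (map (inv num) xs))"
    using recursive_on_letters[OF assms(1)] by simp
  then have "recursive_fun k (\<lambda>xs. \<Phi> (map (inv num) (map (\<lambda>g. g xs) (map e [0..<m]))))"
    by (rule recursive_comp) (auto simp: assms(2))
  then show ?thesis
    by (simp add: comp_def)
qed

lemma recursive_num_inv:
  fixes num :: "'a::finite \<Rightarrow> nat"
  assumes "inj num" and "recursive_fun k a"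
  shows "recursive_fun k (\<lambda>xs. num (inv num (a xs)))"
  using recursive_letters[OF assms(1), where m = 1 and e = "\<lambda>_. a" and \<Phi> = "\<lambda>w. num (hd w)"] assms(2)
  by simp

section \<open>The Baire category theorem for configurations\<close>

definition cylinder :: "(int \<Rightarrow> 'a) \<Rightarrow> nat \<Rightarrow> (int \<Rightarrow> 'a) set" where
  "cylinder x m = {y. \<forall>i. \<bar>i\<bar> \<le> int m \<longrightarrow> y i = x i}"

lemma topspace_config [simp]: "topspace config_topology = UNIV"
  by (simp add: config_topology_def PiE_UNIV_domain)

lemma centre_in_cylinder [simp]: "x \<in> cylinder x m"
  by (simp add: cylinder_def)

lemma cylinder_trans: "y \<in> cylinder x m \<Longrightarrow> z \<in> cylinder y m' \<Longrightarrow> m \<le> m' \<Longrightarrow> z \<in> cylinder x m"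
  by (simp add: cylinder_def)

text \<open>The central cylinders are a base, so that all topological notions reduce to agreement on
  finite windows.\<close>

lemma openin_config_iff:
  "openin config_topology U \<longleftrightarrow> (\<forall>x\<in>U. \<exists>m. cylinder x m \<subseteq> U)"
proof (intro iffI ballI)
  fix x assume "openin config_topology U" "x \<in> U"
  then obtain V where fin: "finite {i. V i \<noteq> UNIV}" and x: "x \<in> Pi\<^sub>E UNIV V" and V: "Pi\<^sub>E UNIV V \<subseteq> U"
    unfolding config_topology_def openin_product_topology_alt by fastforce
  have "cylinder x (Max (insert 0 ((\<lambda>i. nat \<bar>i\<bar>) ` {i. V i \<noteq> UNIV}))) \<subseteq> Pi\<^sub>E UNIV V"
  proof
    fix y assume y: "y \<in> cylinder x (Max (insert 0 ((\<lambda>i. nat \<bar>i\<bar>) ` {i. V i \<noteq> UNIV})))"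
    have "y i \<in> V i" for i
    proof (cases "V i = UNIV")
      case False
      then have "nat \<bar>i\<bar> \<le> Max (insert 0 ((\<lambda>i. nat \<bar>i\<bar>) ` {i. V i \<noteq> UNIV}))"
        using fin by (intro Max_ge) auto
      then have "y i = x i"
        using y by (simp add: cylinder_def)
      then show ?thesis using x by auto
    qed simp
    then show "y \<in> Pi\<^sub>E UNIV V" by auto
  qed
  then show "\<exists>m. cylinder x m \<subseteq> U" using V by blast
next
  assume U: "\<forall>x\<in>U. \<exists>m. cylinder x m \<subseteq> U"
  show "openin config_topology U"
    unfolding config_topology_def openin_product_topology_alt
  proof
    fix x assume "x \<in> U"
    then obtain m where m: "cylinder x m \<subseteq> U" using U by blast
    let ?V = "\<lambda>i. if \<bar>i\<bar> \<le> int m then {x i} else UNIV"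
    have "{i \<in> UNIV. ?V i \<noteq> topspace (discrete_topology UNIV)} \<subseteq> {- int m..int m}"
      by (auto split: if_splits)
    then have "finite {i \<in> UNIV. ?V i \<noteq> topspace (discrete_topology UNIV)}"
      by (rule finite_subset) simp
    moreover have "x \<in> Pi\<^sub>E UNIV ?V" by (simp add: PiE_UNIV_domain)
    moreover have "Pi\<^sub>E UNIV ?V \<subseteq> cylinder x m"
    proof
      fix y assume "y \<in> Pi\<^sub>E UNIV ?V"
      then have V: "y i \<in> ?V i" for i by (rule PiE_mem) simp
      have "y i = x i" if "\<bar>i\<bar> \<le> int m" for i
        using V[of i] that by simp
      then show "y \<in> cylinder x m"
        by (simp add: cylinder_def)
    qed
    ultimately show "\<exists>V. finite {i \<in> UNIV. V i \<noteq> topspace (discrete_topology UNIV)} \<and>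
        (\<forall>i\<in>UNIV. openin (discrete_topology UNIV) (V i)) \<and> x \<in> Pi\<^sub>E UNIV V \<and> Pi\<^sub>E UNIV V \<subseteq> U"
      using m by (intro exI[of _ ?V]) auto
  qed
qed

lemma openin_cylinder: "openin config_topology (cylinder x m)"
  unfolding openin_config_iff by (auto intro!: exI[of _ m] elim: cylinder_trans)

lemma closedin_config_iff:
  "closedin config_topology K \<longleftrightarrow> (\<forall>x. x \<notin> K \<longrightarrow> (\<exists>m. cylinder x m \<inter> K = {}))"
  unfolding closedin_def openin_config_iff by (auto simp: disjoint_iff subset_iff)

lemma in_closure_config_iff:
  "x \<in> config_topology closure_of S \<longleftrightarrow> (\<forall>m. \<exists>y\<in>S. y \<in> cylinder x m)"
proof
  assume "x \<in> config_topology closure_of S"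
  then show "\<forall>m. \<exists>y\<in>S. y \<in> cylinder x m"
    unfolding in_closure_of by (metis openin_cylinder centre_in_cylinder)
next
  assume "\<forall>m. \<exists>y\<in>S. y \<in> cylinder x m"
  then show "x \<in> config_topology closure_of S"
    unfolding in_closure_of openin_config_iff by (simp add: subset_iff) metis
qed

lemma in_omega_limit_iff:
  "y \<in> omega_limit f x \<longleftrightarrow> (\<forall>N m. \<exists>n\<ge>N. (f ^^ n) x \<in> cylinder y m)"
proof -
  have "(\<exists>z\<in>{(f ^^ n) x |n. n \<ge> N}. z \<in> cylinder y m) \<longleftrightarrow> (\<exists>n\<ge>N. (f ^^ n) x \<in> cylinder y m)" for N m
    by auto
  then show ?thesis
    by (simp add: omega_limit_def in_closure_config_iff)
qed

lemma compact_config: "compact_space (config_topology :: (int \<Rightarrow> 'a::finite) topology)"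
  unfolding config_topology_def
  by (simp add: compact_space_product_topology compact_space_discrete_topology)

lemma countable_cylinders: "countable (range (\<lambda>(x :: int \<Rightarrow> 'a::finite, m). cylinder x m))"
proof -
  have "finite (range (\<lambda>x :: int \<Rightarrow> 'a. cylinder x m))" for m
  proof (rule finite_subset)
    let ?F = "{- int m..int m} \<rightarrow>\<^sub>E (UNIV :: 'a set)"
    show "finite ((\<lambda>x. cylinder x m) ` ?F)"
      by (intro finite_imageI finite_PiE) auto
    show "range (\<lambda>x :: int \<Rightarrow> 'a. cylinder x m) \<subseteq> (\<lambda>x. cylinder x m) ` ?F"
    proof
      fix C assume "C \<in> range (\<lambda>x :: int \<Rightarrow> 'a. cylinder x m)"
      then obtain x where C: "C = cylinder x m" by auto
      have "C = cylinder (restrict x {- int m..int m}) m"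
        unfolding C cylinder_def by (rule Collect_cong) (auto simp: abs_le_iff)
      then show "C \<in> (\<lambda>x. cylinder x m) ` ?F" by auto
    qed
  qed
  then have "countable (\<Union>m. range (\<lambda>x :: int \<Rightarrow> 'a. cylinder x m))"
    by (blast intro: countable_UN countable_finite countableI_type)
  moreover have "range (\<lambda>(x :: int \<Rightarrow> 'a, m). cylinder x m) = (\<Union>m. range (\<lambda>x. cylinder x m))"
    by auto
  ultimately show ?thesis by simp
qed

lemma meager_subset:
  assumes "meager S" and "T \<subseteq> S"
  shows "meager T"
proof -
  obtain \<N> where \<N>: "countable \<N>" "S = \<Union>\<N>"
    "\<And>N. N \<in> \<N> \<Longrightarrow> config_topology interior_of (config_topology closure_of N) = {}"
    using assms(1) unfolding meager_def by blast
  have "config_topology interior_of (config_topology closure_of (N \<inter> T)) = {}" if "N \<in> \<N>" for N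
    using \<N>(3)[OF that] interior_of_mono[OF closure_of_mono[of "N \<inter> T" N]] by blast
  moreover have "T = \<Union>((\<lambda>N. N \<inter> T) ` \<N>)"
    using assms(2) \<N>(2) by blast
  ultimately show ?thesis
    unfolding meager_def using \<N>(1) by (intro exI[of _ "(\<lambda>N. N \<inter> T) ` \<N>"]) auto
qed

lemma meager_Union:
  assumes "countable \<S>" and "\<And>S. S \<in> \<S> \<Longrightarrow> meager S"
  shows "meager (\<Union>\<S>)"
proof -
  let ?Q = "\<lambda>S \<N>. countable \<N> \<and> S = \<Union>\<N> \<and>
    (\<forall>N\<in>\<N>. config_topology interior_of (config_topology closure_of N) = {})"
  have "\<forall>S\<in>\<S>. \<exists>\<N>. ?Q S \<N>"
    using assms(2) unfolding meager_def by blast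
  then obtain \<N> where \<N>: "\<And>S. S \<in> \<S> \<Longrightarrow> ?Q S (\<N> S)"
    by (metis (no_types, lifting))
  have "?Q (\<Union>\<S>) (\<Union>S\<in>\<S>. \<N> S)"
  proof (intro conjI)
    show "countable (\<Union>S\<in>\<S>. \<N> S)"
      using assms(1) \<N> by (intro countable_UN) auto
    have "\<Union>\<S> = (\<Union>S\<in>\<S>. \<Union>(\<N> S))"
      using \<N> by auto
    then show "\<Union>\<S> = \<Union>(\<Union>S\<in>\<S>. \<N> S)" by blast
    show "\<forall>N\<in>(\<Union>S\<in>\<S>. \<N> S). config_topology interior_of (config_topology closure_of N) = {}"
    proof
      fix N assume "N \<in> (\<Union>S\<in>\<S>. \<N> S)"
      then obtain S where "S \<in> \<S>" "N \<in> \<N> S" by auto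
      then show "config_topology interior_of (config_topology closure_of N) = {}"
        using \<N>[of S] by simp
    qed
  qed
  then show ?thesis
    unfolding meager_def by (rule exI)
qed

lemma comeager_mono: "comeager S \<Longrightarrow> S \<subseteq> T \<Longrightarrow> comeager T"
  unfolding comeager_def by (auto elim: meager_subset)

lemma comeager_Inter:
  assumes "countable \<S>" and "\<And>S. S \<in> \<S> \<Longrightarrow> comeager S"
  shows "comeager (\<Inter>\<S>)"
proof -
  have "meager (\<Union>(uminus ` \<S>))"
    using assms by (intro meager_Union) (auto simp: comeager_def)
  then show ?thesis
    unfolding comeager_def by (rule meager_subset) auto
qed

lemma comeager_Int: "comeager S \<Longrightarrow> comeager T \<Longrightarrow> comeager (S \<inter> T)"
  using comeager_Inter[of "{S, T}"] by auto

lemma comeager_open_dense: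
  assumes "openin config_topology U" and "\<And>x m. U \<inter> cylinder x m \<noteq> {}"
  shows "comeager U"
proof -
  have "closedin config_topology (- U)"
    using assms(1) by (simp add: closedin_def)
  moreover have "config_topology interior_of (- U) = {}"
    unfolding interior_of_eq_empty openin_config_iff using assms(2) by blast
  ultimately show ?thesis
    unfolding comeager_def meager_def
    by (intro exI[of _ "{- U}"]) (auto simp: closure_of_closedin)
qed

text \<open>This is the Baire category theorem for the compact regular space of configurations.\<close>

lemma comeager_meets_cylinder:
  fixes S :: "(int \<Rightarrow> 'a::finite) set"
  assumes "comeager S"
  shows "S \<inter> cylinder x m \<noteq> {}"
proof -
  obtain \<N> where \<N>: "countable \<N>" "- S = \<Union>\<N>"
    "\<And>N. N \<in> \<N> \<Longrightarrow> config_topology interior_of (config_topology closure_of N) = {}"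
    using assms unfolding comeager_def meager_def by blast
  let ?\<C> = "(\<lambda>N. config_topology closure_of N) ` \<N>"
  have "regular_space (config_topology :: (int \<Rightarrow> 'a) topology)"
    unfolding config_topology_def by (simp add: regular_space_product_topology)
  then have "config_topology interior_of \<Union>?\<C> = {}"
    using \<N> by (intro Baire_category_alt) (auto intro: compact_config compact_imp_locally_compact_space)
  then have "\<not> cylinder x m \<subseteq> \<Union>?\<C>"
    using interior_of_maximal[OF _ openin_cylinder, of x m "\<Union>?\<C>"] centre_in_cylinder[of x m]
    by (metis empty_iff subset_empty)
  moreover have "- S \<subseteq> \<Union>?\<C>"
  proof -
    have "N \<subseteq> config_topology closure_of N" for N :: "(int \<Rightarrow> 'a) set"
      by (rule closure_of_subset) simp
    then show ?thesis
      unfolding \<N>(2) by (intro Union_least) auto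
  qed
  ultimately show ?thesis by blast
qed

section \<open>Recurrence of words and the generic limit set\<close>

lemma closedin_generic_limit_set: "closedin config_topology (generic_limit_set f)"
proof -
  have "generic_attractor f UNIV"
    using comeager_open_dense[of UNIV]
    by (auto simp: generic_attractor_def basin_def closedin_config_iff openin_config_iff intro: centre_in_cylinder)
  then show ?thesis
    unfolding generic_limit_set_def
    by (intro closedin_Inter) (auto simp: generic_attractor_def)
qed

text \<open>The generic attractors may form an uncountable family, but countably many of them have the
  same intersection: one for each cylinder that some generic attractor avoids. An intersection of
  countably many comeager basins is comeager.\<close>

lemma comeager_basin_generic_limit_set:
  fixes f :: "(int \<Rightarrow> 'a::finite) \<Rightarrow> (int \<Rightarrow> 'a)"
  shows "comeager (basin f (generic_limit_set f))"
proof -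
  define \<C> where "\<C> = {C \<in> range (\<lambda>(x, m). cylinder x m). \<exists>K. generic_attractor f K \<and> C \<inter> K = {}}"
  have "countable \<C>"
    using countable_cylinders unfolding \<C>_def by (rule countable_subset[rotated]) auto
  have "\<forall>C\<in>\<C>. \<exists>K. generic_attractor f K \<and> C \<inter> K = {}"
    unfolding \<C>_def by simp
  then obtain K where K: "\<And>C. C \<in> \<C> \<Longrightarrow> generic_attractor f (K C) \<and> C \<inter> K C = {}"
    by metis
  have "(\<Inter>C\<in>\<C>. K C) \<subseteq> generic_limit_set f"
    unfolding generic_limit_set_def
  proof (intro subsetI InterI; rule ccontr)
    fix x L assume x: "x \<in> (\<Inter>C\<in>\<C>. K C)" and L: "L \<in> {K. generic_attractor f K}" and "x \<notin> L"
    then obtain m where "cylinder x m \<inter> L = {}"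
      unfolding generic_attractor_def closedin_config_iff by blast
    then have "cylinder x m \<in> \<C>"
      using L unfolding \<C>_def by auto
    then show False
      using K[of "cylinder x m"] x centre_in_cylinder[of x m] by blast
  qed
  then have "(\<Inter>C\<in>\<C>. basin f (K C)) \<subseteq> basin f (generic_limit_set f)"
    unfolding basin_def by blast
  moreover have "comeager (\<Inter>C\<in>\<C>. basin f (K C))"
    using K \<open>countable \<C>\<close> by (intro comeager_Inter) (auto simp: generic_attractor_def)
  ultimately show ?thesis
    by (rule comeager_mono[rotated])
qed

definition word_at :: "'a list \<Rightarrow> int \<Rightarrow> (int \<Rightarrow> 'a) set" where
  "word_at s i = {x. \<forall>k<length s. x (i + int k) = s ! k}"

lemma in_language_iff: "s \<in> language X \<longleftrightarrow> (\<exists>i. X \<inter> word_at s i \<noteq> {})"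
proof -
  have "s = map g [0..<length s] \<longleftrightarrow> (\<forall>k<length s. g k = s ! k)" for g
    by (subst list_eq_iff_nth_eq) auto
  then show ?thesis
    unfolding language_def word_at_def by auto
qed

lemma word_at_cylinder:
  assumes "x \<in> word_at s i \<longleftrightarrow> b"
  obtains m where "\<And>y. y \<in> cylinder x m \<Longrightarrow> y \<in> word_at s i \<longleftrightarrow> b"
proof
  fix y assume "y \<in> cylinder x (nat \<bar>i\<bar> + length s)"
  then have "y (i + int k) = x (i + int k)" if "k < length s" for k
    using that by (auto simp: cylinder_def)
  then show "y \<in> word_at s i \<longleftrightarrow> b"
    using assms by (auto simp: word_at_def)
qed

lemma clopen_word_at:
  "openin config_topology (word_at s i)" "closedin config_topology (word_at s i)"
proof -
  have "\<exists>m. cylinder x m \<subseteq> word_at s i" if "x \<in> word_at s i" for x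
    using that word_at_cylinder[of x s i True] by (metis subsetI)
  then show "openin config_topology (word_at s i)"
    unfolding openin_config_iff by simp
  have "\<exists>m. cylinder x m \<inter> word_at s i = {}" if "x \<notin> word_at s i" for x
    using that word_at_cylinder[of x s i False] by (metis disjoint_iff)
  then show "closedin config_topology (word_at s i)"
    unfolding closedin_config_iff by simp
qed

text \<open>Openness of the cylinder gives one direction; compactness gives the other, the sets of
  accumulation points of the tails of the orbit inside the closed cylinder being nested and
  nonempty.\<close>

lemma omega_limit_meets_word_iff:
  fixes f :: "(int \<Rightarrow> 'a::finite) \<Rightarrow> (int \<Rightarrow> 'a)"
  shows "omega_limit f x \<inter> word_at s i \<noteq> {} \<longleftrightarrow> (\<forall>N. \<exists>n\<ge>N. (f ^^ n) x \<in> word_at s i)"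
proof
  assume "omega_limit f x \<inter> word_at s i \<noteq> {}"
  then obtain y where y: "y \<in> omega_limit f x" "y \<in> word_at s i" by auto
  then obtain m where m: "cylinder y m \<subseteq> word_at s i"
    using clopen_word_at(1)[of s i] unfolding openin_config_iff by auto
  show "\<forall>N. \<exists>n\<ge>N. (f ^^ n) x \<in> word_at s i"
  proof
    fix N
    obtain n where "n \<ge> N" "(f ^^ n) x \<in> cylinder y m"
      using y(1) unfolding in_omega_limit_iff by auto
    then show "\<exists>n\<ge>N. (f ^^ n) x \<in> word_at s i"
      using m by auto
  qed
next
  assume inf: "\<forall>N. \<exists>n\<ge>N. (f ^^ n) x \<in> word_at s i"
  define C where "C N = config_topology closure_of {(f ^^ n) x |n. n \<ge> N} \<inter> word_at s i" for N
  have "(\<Inter>N. C N) \<noteq> {}"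
  proof (rule compact_space_imp_nest[OF compact_config])
    show "closedin config_topology (C N)" for N
      unfolding C_def by (intro closedin_Int closedin_closure_of clopen_word_at)
    show "decseq C"
      unfolding C_def decseq_def by (intro allI impI Int_mono closure_of_mono) auto
    show "C N \<noteq> {}" for N
    proof -
      obtain n where "n \<ge> N" "(f ^^ n) x \<in> word_at s i" using inf by blast
      then have "(f ^^ n) x \<in> C N"
        unfolding C_def by (auto simp: in_closure_config_iff intro!: exI[of _ n])
      then show ?thesis by auto
    qed
  qed
  then show "omega_limit f x \<inter> word_at s i \<noteq> {}"
    unfolding C_def omega_limit_def by blast
qed

definition densely_recurrent :: "((int \<Rightarrow> 'a) \<Rightarrow> (int \<Rightarrow> 'a)) \<Rightarrow> 'a list \<Rightarrow> int \<Rightarrow> bool" where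
  "densely_recurrent f s i \<longleftrightarrow> (\<forall>x m N. \<exists>n\<ge>N. \<exists>y\<in>cylinder x m. (f ^^ n) y \<in> word_at s i)"

text \<open>Minimality makes the basin of the generic limit set without the occurrences of \<^term>\<open>s\<close> at
  \<^term>\<open>i\<close> meager. So generic points have their limit set in the generic limit set but not in
  this smaller set.\<close>

lemma densely_recurrent_if_in_language:
  fixes f :: "(int \<Rightarrow> 'a::finite) \<Rightarrow> (int \<Rightarrow> 'a)"
  assumes "inclusion_minimal f (generic_limit_set f)"
    and "generic_limit_set f \<inter> word_at s i \<noteq> {}"
  shows "densely_recurrent f s i"
proof -
  let ?B = "generic_limit_set f - word_at s i"
  have "closedin config_topology ?B"
    by (intro closedin_diff closedin_generic_limit_set clopen_word_at)
  moreover have "?B \<subset> generic_limit_set f"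
    using assms(2) by blast
  ultimately have "meager (basin f ?B)"
    using assms(1) unfolding inclusion_minimal_def by blast
  then have "comeager (basin f (generic_limit_set f) \<inter> - basin f ?B)"
    by (intro comeager_Int comeager_basin_generic_limit_set) (simp add: comeager_def)
  then have *: "\<exists>y\<in>cylinder x m. y \<in> basin f (generic_limit_set f) \<and> y \<notin> basin f ?B" for x m
    using comeager_meets_cylinder[of _ x m] by blast
  have "\<exists>n\<ge>N. \<exists>y\<in>cylinder x m. (f ^^ n) y \<in> word_at s i" for x m N
  proof -
    obtain y where "y \<in> cylinder x m" "y \<in> basin f (generic_limit_set f)" "y \<notin> basin f ?B"
      using * by blast
    moreover from this have "omega_limit f y \<inter> word_at s i \<noteq> {}"
      unfolding basin_def by blast
    ultimately show ?thesis
      unfolding omega_limit_meets_word_iff by blast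
  qed
  then show ?thesis unfolding densely_recurrent_def by blast
qed

text \<open>The points that visit the cylinder infinitely often form a countable intersection of dense open
  sets, so one of them is in the comeager basin of the generic limit set.\<close>

lemma generic_limit_set_meets_word:
  fixes f :: "(int \<Rightarrow> 'a::finite) \<Rightarrow> (int \<Rightarrow> 'a)"
  assumes "\<And>n U. openin config_topology U \<Longrightarrow> openin config_topology ((f ^^ n) -` U)"
    and "densely_recurrent f s i"
  shows "generic_limit_set f \<inter> word_at s i \<noteq> {}"
proof -
  define U where "U N = (\<Union>n\<in>{N..}. (f ^^ n) -` word_at s i)" for N
  have "comeager (U N)" for N
  proof (rule comeager_open_dense)
    show "openin config_topology (U N)"
      unfolding U_def by (intro openin_Union) (auto intro: assms clopen_word_at)
    show "U N \<inter> cylinder x m \<noteq> {}" for x m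
    proof -
      obtain n y where "n \<ge> N" "y \<in> cylinder x m" "(f ^^ n) y \<in> word_at s i"
        using assms(2) unfolding densely_recurrent_def by blast
      then show ?thesis unfolding U_def by blast
    qed
  qed
  then have "comeager ((\<Inter>N. U N) \<inter> basin f (generic_limit_set f))"
    by (intro comeager_Int comeager_Inter comeager_basin_generic_limit_set) auto
  then obtain x where x: "\<And>N. x \<in> U N" "x \<in> basin f (generic_limit_set f)"
    using comeager_meets_cylinder[of _ undefined 0] by blast
  have "\<forall>N. \<exists>n\<ge>N. (f ^^ n) x \<in> word_at s i"
  proof
    fix N show "\<exists>n\<ge>N. (f ^^ n) x \<in> word_at s i"
      using x(1)[of N] unfolding U_def by auto
  qed
  then have "omega_limit f x \<inter> word_at s i \<noteq> {}"
    unfolding omega_limit_meets_word_iff .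
  then show ?thesis
    using x(2) unfolding basin_def by blast
qed

section \<open>Space-time diagrams\<close>

definition local_rule :: "((int \<Rightarrow> 'a) \<Rightarrow> (int \<Rightarrow> 'a)) \<Rightarrow> nat \<Rightarrow> ('a list \<Rightarrow> 'a) \<Rightarrow> bool" where
  "local_rule f r F \<longleftrightarrow> (\<forall>x i. f x i = F (map x [i - int r..i + int r]))"

text \<open>The automaton followed by a shift by the radius, so that a cell depends only on the cells to its
  right. This allows configurations indexed by natural numbers.\<close>

definition one_sided :: "nat \<Rightarrow> ('a list \<Rightarrow> 'a) \<Rightarrow> (nat \<Rightarrow> 'a) \<Rightarrow> nat \<Rightarrow> 'a" where
  "one_sided r F c i = F (map (\<lambda>j. c (i + j)) [0..<2 * r + 1])"

lemma openin_vimage_funpow: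
  assumes f: "local_rule f r F" and "openin config_topology U"
  shows "openin config_topology ((f ^^ n) -` U)"
  using assms(2)
proof (induction n arbitrary: U)
  case (Suc n)
  have "openin config_topology (f -` U)"
    unfolding openin_config_iff
  proof
    fix x assume "x \<in> f -` U"
    then obtain m where m: "cylinder (f x) m \<subseteq> U"
      using Suc.prems unfolding openin_config_iff by auto
    have "f y \<in> cylinder (f x) m" if "y \<in> cylinder x (m + r)" for y
    proof -
      have "f y i = f x i" if "\<bar>i\<bar> \<le> int m" for i
      proof -
        have "map y [i - int r..i + int r] = map x [i - int r..i + int r]"
          using that \<open>y \<in> cylinder x (m + r)\<close> by (intro map_cong) (auto simp: cylinder_def)
        then show ?thesis using f by (metis local_rule_def)
      qed
      then show ?thesis by (simp add: cylinder_def)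
    qed
    then show "\<exists>m. cylinder x m \<subseteq> f -` U"
      using m by (intro exI[of _ "m + r"]) auto
  qed
  from Suc.IH[OF this] show ?case
    by (simp add: vimage_def)
qed simp

text \<open>Each step of the one-sided map lags behind the automaton by a shift of \<^term>\<open>r\<close> cells.\<close>

lemma one_sided_funpow:
  assumes f: "local_rule f r F" and c: "\<And>p. c p = x (int p + a)"
  shows "(one_sided r F ^^ n) c p = (f ^^ n) x (int p + a + int (r * n))"
proof (induction n arbitrary: p)
  case (Suc n)
  have window: "[i - int r..i + int r] = map (\<lambda>j. i - int r + int j) [0..<2 * r + 1]" for i
    by (rule nth_equalityI) (auto simp: nth_upto simp del: upt_Suc)
  define q where "q = int p + a + int (r * Suc n)"
  have "(one_sided r F ^^ Suc n) c p = F (map (\<lambda>j. (one_sided r F ^^ n) c (p + j)) [0..<2 * r + 1])"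
    by (simp only: funpow.simps comp_def one_sided_def[of _ _ "(one_sided r F ^^ n) c"])
  also have "\<dots> = F (map (\<lambda>j. (f ^^ n) x (q - int r + int j)) [0..<2 * r + 1])"
    unfolding Suc q_def by (simp add: algebra_simps del: upt_Suc)
  also have "\<dots> = f ((f ^^ n) x) q"
    using f unfolding local_rule_def window map_map comp_def by simp
  finally show ?case
    by (simp add: q_def)
qed (simp add: c)

text \<open>The rows are the one-sided iterates of the row 0. The pattern \<^term>\<open>w\<close> starts at
  \<^term>\<open>r * n\<close> in row 0 and the target \<^term>\<open>s\<close> at \<^term>\<open>k\<close> in row \<^term>\<open>n\<close>; as \<^term>\<open>n\<close>
  steps lag by \<^term>\<open>r * n\<close>, in the coordinates of the automaton this puts \<^term>\<open>s\<close> at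
  offset \<^term>\<open>k\<close> from the start of \<^term>\<open>w\<close>. The number \<^term>\<open>k\<close> is at the same time the
  lower bound for the time. The rule is imposed on equally long
  pieces of all rows, so the cells near the right end of a row need not belong to the orbit of
  row 0. The pieces are long enough to keep these cells away from \<^term>\<open>s\<close>.\<close>

definition diagram :: "nat \<Rightarrow> ('a list \<Rightarrow> 'a) \<Rightarrow> 'a list \<Rightarrow> nat \<Rightarrow> 'a list \<Rightarrow> nat \<Rightarrow> (nat \<Rightarrow> nat \<Rightarrow> 'a) \<Rightarrow> bool" where
  "diagram r F s k w n D \<longleftrightarrow>
     k \<le> n \<and>
     (\<forall>i<length w. D 0 (r * n + i) = w ! i) \<and>
     (\<forall>i<length s. D n (k + i) = s ! i) \<and>
     (\<forall>t<n. \<forall>i<k + length s + 2 * r * n. D (Suc t) i = one_sided r F (D t) i)"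

text \<open>The uncontrolled cells at the right end spread to the left by \<^term>\<open>2 * r\<close> cells per step.\<close>

lemma diagram_orbit:
  assumes "diagram r F s k w n D" and "t \<le> n" and "i + 2 * r * t < k + length s + 2 * r * n"
  shows "D t i = (one_sided r F ^^ t) (D 0) i"
  using assms(2,3)
proof (induction t arbitrary: i)
  case (Suc t)
  have "D t (i + j) = (one_sided r F ^^ t) (D 0) (i + j)" if "j < 2 * r + 1" for j
    using Suc.prems that by (intro Suc.IH) auto
  then have "one_sided r F (D t) i = one_sided r F ((one_sided r F ^^ t) (D 0)) i"
    unfolding one_sided_def by (intro arg_cong[where f = F] map_cong) auto
  moreover have "D (Suc t) i = one_sided r F (D t) i"
    using assms(1) Suc.prems unfolding diagram_def by auto
  ultimately show ?case by simp
qed simp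

text \<open>The pattern is written at distance \<^term>\<open>k\<close> to the left of the position \<^term>\<open>i\<close>, whatever
  \<^term>\<open>i\<close> is. This is where the position of the occurrence disappears from the condition.\<close>

lemma ex_diagram_if_densely_recurrent:
  assumes f: "local_rule f r F" and "densely_recurrent f s i"
  shows "\<exists>n D. diagram r F s k w n D"
proof -
  \<comment> \<open>Only the values on the positions of the pattern matter; the window below contains them all.\<close>
  define x where "x j = w ! nat (j - (i - int k))" for j
  obtain n y where n: "n \<ge> k" and y: "y \<in> cylinder x (nat \<bar>i\<bar> + k + length w)"
    and hit: "(f ^^ n) y \<in> word_at s i"
    using assms(2) unfolding densely_recurrent_def by blast
  define c where "c p = y (int p + (i - int k - int (r * n)))" for p
  have orbit: "(one_sided r F ^^ t) c p = (f ^^ t) y (int p + (i - int k - int (r * n)) + int (r * t))" for t p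
    by (rule one_sided_funpow[OF f]) (simp add: c_def)
  have "c (r * n + j) = w ! j" if "j < length w" for j
  proof -
    have "c (r * n + j) = y (i - int k + int j)"
      unfolding c_def by (rule arg_cong[where f = y]) simp
    also have "\<dots> = x (i - int k + int j)"
      using y that unfolding cylinder_def by auto
    finally show ?thesis by (simp add: x_def)
  qed
  moreover have "(one_sided r F ^^ n) c (k + j) = s ! j" if "j < length s" for j
    using hit that unfolding orbit word_at_def by (simp add: algebra_simps)
  ultimately have "diagram r F s k w n (\<lambda>t. (one_sided r F ^^ t) c)"
    using n unfolding diagram_def by simp
  then show ?thesis by blast
qed

text \<open>The given pattern is extended to the window of radius \<^term>\<open>k\<close>, for \<^term>\<open>k\<close> large enough to
  serve also as the time bound. The offset \<^term>\<open>k\<close> of the target from the left end of this window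
  is then the origin.\<close>

lemma densely_recurrent_if_ex_diagram:
  assumes f: "local_rule f r F" and D: "\<And>k w. \<exists>n D. diagram r F s k w n D"
  shows "densely_recurrent f s 0"
  unfolding densely_recurrent_def
proof (intro allI)
  fix x :: "int \<Rightarrow> 'a" and m N :: nat
  define k where "k = max m N"
  define w where "w = map (\<lambda>j. x (int j - int k)) [0..<2 * k + 1]"
  obtain n D where D: "diagram r F s k w n D"
    using assms(2) by blast
  \<comment> \<open>To the left of the diagram the configuration is constant; these cells lie outside the window.\<close>
  define y where "y i = D 0 (nat (i + int k + int (r * n)))" for i
  have orbit: "(one_sided r F ^^ n) (D 0) p = (f ^^ n) y (int p + (- int k - int (r * n)) + int (r * n))" for p
    by (rule one_sided_funpow[OF f]) (simp add: y_def)
  have "y i = x i" if "\<bar>i\<bar> \<le> int k" for i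
  proof -
    have "nat (i + int k + int (r * n)) = r * n + nat (i + int k)"
      using that by (simp add: nat_add_distrib nat_mult_distrib)
    moreover have "nat (i + int k) < length w"
      using that by (simp add: w_def)
    moreover have "\<forall>j<length w. D 0 (r * n + j) = w ! j"
      using D unfolding diagram_def by blast
    ultimately have "y i = w ! nat (i + int k)"
      by (simp add: y_def)
    also have "\<dots> = x i"
      unfolding w_def using that by (subst nth_map) (auto simp: nth_upt simp del: upt_Suc)
    finally show ?thesis .
  qed
  then have "y \<in> cylinder x m"
    by (simp add: cylinder_def k_def)
  moreover have "(f ^^ n) y (0 + int j) = s ! j" if "j < length s" for j
  proof -
    have "(f ^^ n) y (0 + int j) = (one_sided r F ^^ n) (D 0) (k + j)"
      unfolding orbit by simp
    also have "\<dots> = D n (k + j)"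
      using that by (intro diagram_orbit[OF D, symmetric]) auto
    also have "\<dots> = s ! j"
      using D that unfolding diagram_def by blast
    finally show ?thesis .
  qed
  then have "(f ^^ n) y \<in> word_at s 0"
    by (simp add: word_at_def)
  moreover have "n \<ge> N"
    using D unfolding diagram_def k_def by simp
  ultimately show "\<exists>n\<ge>N. \<exists>y\<in>cylinder x m. (f ^^ n) y \<in> word_at s 0"
    by blast
qed

lemma in_language_generic_limit_set_iff:
  fixes f :: "(int \<Rightarrow> 'a::finite) \<Rightarrow> (int \<Rightarrow> 'a)"
  assumes "local_rule f r F" and "inclusion_minimal f (generic_limit_set f)"
  shows "s \<in> language (generic_limit_set f) \<longleftrightarrow> (\<forall>k w. \<exists>n D. diagram r F s k w n D)"
proof
  assume "s \<in> language (generic_limit_set f)"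
  then obtain i where "densely_recurrent f s i"
    using densely_recurrent_if_in_language[OF assms(2)] unfolding in_language_iff by auto
  then show "\<forall>k w. \<exists>n D. diagram r F s k w n D"
    using ex_diagram_if_densely_recurrent[OF assms(1)] by auto
next
  assume "\<forall>k w. \<exists>n D. diagram r F s k w n D"
  then have "densely_recurrent f s 0"
    using densely_recurrent_if_ex_diagram[OF assms(1)] by auto
  then have "generic_limit_set f \<inter> word_at s 0 \<noteq> {}"
    by (intro generic_limit_set_meets_word openin_vimage_funpow[OF assms(1)])
  then show "s \<in> language (generic_limit_set f)"
    unfolding in_language_iff by auto
qed

section \<open>Recursive verification of space-time diagrams\<close>

definition code_cell :: "('a \<Rightarrow> nat) \<Rightarrow> nat \<Rightarrow> nat \<Rightarrow> nat \<Rightarrow> 'a" where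
  "code_cell num d t i = inv num (code_nth (code_nth d t) i)"

definition decode_word :: "('a \<Rightarrow> nat) \<Rightarrow> nat \<Rightarrow> 'a list" where
  "decode_word num c = map (inv num) (list_decode c)"

text \<open>The number \<^term>\<open>y\<close> codes the offset and the pattern, \<^term>\<open>z\<close> codes the time and the rows
  of the diagram. Every number decodes to a letter, so \<^term>\<open>y\<close> and \<^term>\<open>z\<close> need no test for
  being well-formed. The first conjunct is such a test for \<^term>\<open>s\<close>: without it a number that
  codes no word would be accepted together with the word it decodes to.\<close>

definition code_diagram :: "('a \<Rightarrow> nat) \<Rightarrow> nat \<Rightarrow> ('a list \<Rightarrow> 'a) \<Rightarrow> nat \<Rightarrow> nat \<Rightarrow> nat \<Rightarrow> bool" where
  "code_diagram num r F s y z \<longleftrightarrow>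
     (\<forall>i<code_length s. num (inv num (code_nth s i)) = code_nth s i) \<and>
     diagram r F (decode_word num s) (fst (prod_decode y)) (decode_word num (snd (prod_decode y)))
       (fst (prod_decode z)) (code_cell num (snd (prod_decode z)))"

lemma decode_word_encode: "inj num \<Longrightarrow> decode_word num (list_encode (map num w)) = w"
  by (simp add: decode_word_def comp_def)

text \<open>Equality of letters is compared through their numbers, which puts the whole condition into the
  scope of the closure rules.\<close>

lemma recursive_code_diagram:
  fixes num :: "'a::finite \<Rightarrow> nat"
  assumes num: "inj num"
  shows "recursive_pred 3 (\<lambda>xs. code_diagram num r F (xs ! 0) (xs ! 1) (xs ! 2))"
proof -
  have word: "(\<forall>i<length (decode_word num c). g i = decode_word num c ! i) \<longleftrightarrow>
      (\<forall>i<code_length c. g i = inv num (code_nth c i))" for c and g :: "nat \<Rightarrow> 'a"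
    by (auto simp: decode_word_def code_length_def code_nth_conv)
  have len: "length (decode_word num c) = code_length c" for c
    by (simp add: decode_word_def code_length_def)
  have eq: "a = b \<longleftrightarrow> num a = num b" for a b
    using num by (simp add: inj_eq)
  show ?thesis
    unfolding code_diagram_def diagram_def word
    unfolding len one_sided_def code_cell_def eq
    by (intro recursive_conj recursive_bounded_all recursive_eq recursive_le recursive_add recursive_mult
        recursive_const recursive_num_inv[OF num] recursive_letters[OF num, where \<Phi> = "\<lambda>w. num (F w)"]
        recursive_code_nth recursive_code_length recursive_prod_decode recursive_Suc
        recursive_proj recursive_proj_drop recursive_proj_drop_drop) auto
qed

lemma ex_code_diagram_iff:
  fixes num :: "'a::finite \<Rightarrow> nat"
  assumes num: "inj num"
  shows "(\<forall>y. \<exists>z. code_diagram num r F (list_encode (map num s)) y z) \<longleftrightarrow>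
    (\<forall>k w. \<exists>n D. diagram r F s k w n D)"
proof (intro iffI allI)
  fix k w
  assume "\<forall>y. \<exists>z. code_diagram num r F (list_encode (map num s)) y z"
  then obtain z where "code_diagram num r F (list_encode (map num s))
      (prod_encode (k, list_encode (map num w))) z"
    by blast
  then show "\<exists>n D. diagram r F s k w n D"
    unfolding code_diagram_def by (auto simp: decode_word_encode[OF num])
next
  fix y
  assume diag: "\<forall>k w. \<exists>n D. diagram r F s k w n D"
  define k w where "k = fst (prod_decode y)" and "w = decode_word num (snd (prod_decode y))"
  obtain n D where D: "diagram r F s k w n D"
    using diag by blast
  \<comment> \<open>A row must also contain the cells that the rule reads beyond the last cell it is imposed on.\<close>
  define M where "M = r * n + length w + k + length s + 2 * r * n + 2 * r + 1"
  define d where "d = list_encode (map (\<lambda>t. list_encode (map (\<lambda>i. num (D t i)) [0..<M])) [0..<Suc n])"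
  have cell: "code_cell num d t i = D t i" if "t \<le> n" "i < M" for t i
    using that num by (simp add: code_cell_def d_def code_nth_list_encode less_Suc_eq_le del: upt_Suc)
  have "one_sided r F (code_cell num d t) i = one_sided r F (D t) i"
    if "t < n" "i < k + length s + 2 * r * n" for t i
    unfolding one_sided_def using that
    by (intro arg_cong[where f = F] map_cong refl cell) (auto simp: M_def algebra_simps)
  moreover have "code_cell num d (Suc t) i = D (Suc t) i"
    if "t < n" "i < k + length s + 2 * r * n" for t i
    using that by (intro cell) (auto simp: M_def algebra_simps)
  ultimately have "diagram r F s k w n (code_cell num d)"
    using D unfolding diagram_def by (auto simp: cell M_def)
  then have "code_diagram num r F (list_encode (map num s)) y (prod_encode (n, d))"
    using num unfolding code_diagram_def
    by (auto simp: decode_word_encode k_def w_def code_length_def code_nth_conv)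
  then show "\<exists>z. code_diagram num r F (list_encode (map num s)) y z" ..
qed

lemma decidable3_if_recursive_pred:
  assumes "recursive_pred 3 (\<lambda>xs. R (xs ! 0) (xs ! 1) (xs ! 2))"
  shows "decidable3 R"
proof -
  obtain p where p: "\<And>xs. length xs = 3 \<Longrightarrow> evaluates p xs (of_bool (R (xs ! 0) (xs ! 1) (xs ! 2)))"
    using assms unfolding recursive_pred_def recursive_fun_def by auto
  have "evaluates p [x, y, z] (if R x y z then 1 else 0)" for x y z
    using p[of "[x, y, z]"] by (simp add: of_bool_def)
  then show ?thesis unfolding decidable3_def by blast
qed

section \<open>The language of the generic limit set\<close>

theorem proposition4p6:
  fixes f :: "(int \<Rightarrow> 'a::finite) \<Rightarrow> (int \<Rightarrow> 'a)"
  assumes "cellular_automaton f"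
    and "inclusion_minimal f (generic_limit_set f)"
  shows "Pi02_words (language (generic_limit_set f))"
  unfolding Pi02_words_def
proof (intro allI impI)
  fix num :: "'a \<Rightarrow> nat" assume num: "inj num"
  obtain r F where "local_rule f r F"
    using assms(1) unfolding cellular_automaton_def local_rule_def by auto
  note language = in_language_generic_limit_set_iff[OF this assms(2)]
  let ?R = "code_diagram num r F"
  have "(\<lambda>w. list_encode (map num w)) ` language (generic_limit_set f) = {x. \<forall>y. \<exists>z. ?R x y z}"
  proof (intro equalityI subsetI)
    fix x assume "x \<in> (\<lambda>w. list_encode (map num w)) ` language (generic_limit_set f)"
    then obtain w where "w \<in> language (generic_limit_set f)" and x: "x = list_encode (map num w)"
      by auto
    then have "\<forall>y. \<exists>z. ?R x y z"
      using language ex_code_diagram_iff[OF num, of r F w] by simp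
    then show "x \<in> {x. \<forall>y. \<exists>z. ?R x y z}" by simp
  next
    fix x assume x: "x \<in> {x. \<forall>y. \<exists>z. ?R x y z}"
    then have "\<forall>i<code_length x. num (inv num (code_nth x i)) = code_nth x i"
      unfolding code_diagram_def by blast
    then have "map num (decode_word num x) = list_decode x"
      by (intro nth_equalityI) (auto simp: decode_word_def code_length_def code_nth_conv)
    then have "x = list_encode (map num (decode_word num x))"
      by simp
    then show "x \<in> (\<lambda>w. list_encode (map num w)) ` language (generic_limit_set f)"
      using x ex_code_diagram_iff[OF num, of r F "decode_word num x"]
      by (auto simp: language intro!: image_eqI[of _ _ "decode_word num x"])
  qed
  moreover have "decidable3 ?R"
    using recursive_code_diagram[OF num] by (rule decidable3_if_recursive_pred)
  ultimately show "Pi02 ((\<lambda>w. list_encode (map num w)) ` language (generic_limit_set f))"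
    unfolding Pi02_def by blast
qed

end
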